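(* Let $\gamma$ be a smooth, origin-symmetric, closed strictly convex planar curve with positive curvature, parametrized by its Gauss parametrization $\gamma:\mathbb{S}^1\to\mathbb{R}^2$. Then the affine support function $\sigma$ of $\gamma$, regarded as a function on the unit circle, has at least eight critical points, i.e. there are at least eight points of $\mathbb{S}^1$ at which $\sigma_\theta=0$.
   Context: The Gauss parametrization assigns to $\theta$ (identified with $z=(\cos\theta,\sin\theta)\in\mathbb{S}^1$) the point $\gamma(\theta)$ of the curve whose outer unit normal is $z$. The support function is $s(\theta)=\langle\gamma(\theta),(\cos\theta,\sin\theta)\rangle$, the curvature $\kappa$ (as a function of $\theta$) satisfies $1/\kappa=s_{\theta\theta}+s$, and the affine support function is $\sigma=s/\kappa^{1/3}=s\,(s_{\theta\theta}+s)^{1/3}$. *)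

theory Defs
  imports "HOL-Analysis.Analysis"
begin

definition circle_point :: "real \<Rightarrow> real^2" where
  "circle_point \<theta> = vector [cos \<theta>, sin \<theta>]"

text \<open>
  A map \<open>f\<close> on the unit circle is a function on the plane of which only the values on
  \<open>sphere 0 1\<close> matter. Smoothness and derivatives of \<open>f\<close> are those of the
  \<open>2 * pi\<close>-periodic function \<open>angular f\<close> of the angle.
\<close>
definition angular :: "(real^2 \<Rightarrow> 'a) \<Rightarrow> real \<Rightarrow> 'a" where
  "angular f \<theta> = f (circle_point \<theta>)"

definition vderiv :: "(real \<Rightarrow> 'a::real_normed_vector) \<Rightarrow> real \<Rightarrow> 'a" where
  "vderiv f t = vector_derivative f (at t)"

definition smooth :: "(real \<Rightarrow> 'a::real_normed_vector) \<Rightarrow> bool" where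
  "smooth f \<longleftrightarrow> (\<forall>n t. (vderiv ^^ n) f differentiable (at t))"

definition smooth_simple_closed_curve :: "(real^2 \<Rightarrow> real^2) \<Rightarrow> bool" where
  "smooth_simple_closed_curve \<gamma> \<longleftrightarrow>
     smooth (angular \<gamma>) \<and> (\<forall>\<theta>. vderiv (angular \<gamma>) \<theta> \<noteq> 0) \<and> inj_on \<gamma> (sphere 0 1)"

definition curve_points :: "(real^2 \<Rightarrow> real^2) \<Rightarrow> (real^2) set" where
  "curve_points \<gamma> = \<gamma> ` sphere 0 1"

definition strictly_convex_body :: "(real^2) set \<Rightarrow> bool" where
  "strictly_convex_body K \<longleftrightarrow> compact K \<and> convex K \<and> interior K \<noteq> {} \<and>
     (\<forall>x\<in>K. \<forall>y\<in>K. x \<noteq> y \<longrightarrow> open_segment x y \<subseteq> interior K)"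

definition strictly_convex_curve :: "(real^2 \<Rightarrow> real^2) \<Rightarrow> bool" where
  "strictly_convex_curve \<gamma> \<longleftrightarrow> (\<exists>K. strictly_convex_body K \<and> curve_points \<gamma> = frontier K)"

definition origin_symmetric :: "(real^2 \<Rightarrow> real^2) \<Rightarrow> bool" where
  "origin_symmetric \<gamma> \<longleftrightarrow> uminus ` curve_points \<gamma> = curve_points \<gamma>"

text \<open>
  For a convex curve, a unit normal is the outer one iff the curve lies in the closed
  half-plane which the tangent line bounds and which the normal points out of.
\<close>
definition outer_unit_normal :: "(real^2 \<Rightarrow> real^2) \<Rightarrow> real \<Rightarrow> real^2 \<Rightarrow> bool" where
  "outer_unit_normal \<gamma> \<theta> \<nu> \<longleftrightarrow>
     norm \<nu> = 1 \<and> \<nu> \<bullet> vderiv (angular \<gamma>) \<theta> = 0 \<and> (\<forall>q\<in>curve_points \<gamma>. (q - angular \<gamma> \<theta>) \<bullet> \<nu> \<le> 0)"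

definition gauss_parametrization :: "(real^2 \<Rightarrow> real^2) \<Rightarrow> bool" where
  "gauss_parametrization \<gamma> \<longleftrightarrow> (\<forall>\<theta>. outer_unit_normal \<gamma> \<theta> (circle_point \<theta>))"

text \<open>
  Signed curvature of a regular plane curve in an arbitrary parametrization. A Gauss
  parametrization runs counterclockwise, so no further choice of orientation is needed.
\<close>
definition curvature :: "(real^2 \<Rightarrow> real^2) \<Rightarrow> real \<Rightarrow> real" where
  "curvature \<gamma> \<theta> =
     (let v = vderiv (angular \<gamma>) \<theta>; a = vderiv (vderiv (angular \<gamma>)) \<theta>
      in (v $ 1 * a $ 2 - v $ 2 * a $ 1) / norm v ^ 3)"

definition support_function :: "(real^2 \<Rightarrow> real^2) \<Rightarrow> real \<Rightarrow> real" where
  "support_function \<gamma> \<theta> = angular \<gamma> \<theta> \<bullet> circle_point \<theta>"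

definition affine_support_function :: "(real^2 \<Rightarrow> real^2) \<Rightarrow> real \<Rightarrow> real" where
  "affine_support_function \<gamma> \<theta> = support_function \<gamma> \<theta> / root 3 (curvature \<gamma> \<theta>)"

text \<open>
  The critical points are points of the circle, so angles that differ by a multiple of
  \<open>2 * pi\<close> are not counted separately.
\<close>
definition critical_points :: "(real \<Rightarrow> real) \<Rightarrow> (real^2) set" where
  "critical_points f = {circle_point \<theta> |\<theta>. (f has_real_derivative 0) (at \<theta>)}"

end

theory Submission
  imports Defs
begin

text \<open>
  Write \<open>s\<close> for the support function and \<open>\<rho> = s'' + s\<close> for the radius of curvature. Then
  \<open>\<sigma>\<^sup>3 = s\<^sup>3 \<rho>\<close>, and \<open>\<sigma>'\<close> vanishes wherever \<open>3 s' \<rho> + s \<rho>'\<close> does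
  (\<open>affine_support_function_critical\<close>). The point of the proof is that this nonlinear expression
  is linear in the square \<open>u = s\<^sup>2\<close>: it equals \<open>(u''' + 4 u') / 2\<close>.

  The symmetry of the curve makes \<open>s\<close>, and hence \<open>u\<close>, periodic with period \<open>pi\<close>
  (\<open>support_function_periodic\<close>). The functions of period \<open>pi\<close> annihilated by the skew-adjoint
  operator \<open>L u = u''' + 4 u'\<close> are the weights \<open>p t = A - B cos (2 t - d)\<close>, so \<open>L u\<close> is
  orthogonal to all of them over a period. This is the situation of the Sturm-Hurwitz theorem: if
  \<open>L u\<close> had at most three zeros in a half-open period, then a suitable \<open>p\<close> would have the same
  sign as \<open>L u\<close> away from at most three points (\<open>exists_weight_with_signs\<close>), and the product
  \<open>p L u\<close> could not integrate to zero (\<open>no_weight_with_sign\<close>). Thus there are four zeros in each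
  half-open period (\<open>four_zeros_per_period\<close>), and the circle consists of two periods.
\<close>

section \<open>Third-order Sturm-Hurwitz theorem for functions of period pi\<close>

lemma periodic_derivative:
  fixes f f' :: "real \<Rightarrow> real"
  assumes "\<And>t. (f has_real_derivative f' t) (at t)" and "\<And>t. f (t + p) = f t"
  shows "f' (t + p) = f' t"
proof -
  have "((\<lambda>x. f (x + p)) has_real_derivative f' (t + p)) (at t)"
    using assms(1)[of "t + p"] by (simp only: DERIV_shift)
  then have "(f has_real_derivative f' (t + p)) (at t)"
    by (simp only: assms(2))
  then show ?thesis
    using assms(1) DERIV_unique by blast
qed

lemma continuous_nonzero_sign_const:
  fixes g :: "real \<Rightarrow> real"
  assumes "continuous_on UNIV g" and "\<And>t. a < t \<Longrightarrow> t < b \<Longrightarrow> g t \<noteq> 0"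
  shows "\<exists>e. (e = 1 \<or> e = -1) \<and> (\<forall>t. a < t \<longrightarrow> t < b \<longrightarrow> 0 < e * g t)"
proof -
  have no: False if "s \<in> {a<..<b}" "t \<in> {a<..<b}" "g s < 0" "0 < g t" for s t
  proof -
    have "connected (g ` {a<..<b})"
      using continuous_on_subset[OF assms(1) subset_UNIV] connected_Ioo
      by (rule connected_continuous_image)
    then have "0 \<in> g ` {a<..<b}"
      by (rule connectedD_interval[where x = "g s" and y = "g t"])
        (use that in \<open>simp_all only: imageI less_imp_le\<close>)
    then show False using assms(2) by (metis greaterThanLessThan_iff imageE)
  qed
  show ?thesis
  proof (cases "\<exists>s\<in>{a<..<b}. g s < 0")
    case True
    then obtain s where s: "s \<in> {a<..<b}" "g s < 0" by blast
    have "g t < 0" if "a < t" "t < b" for t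
      using no[OF s(1) _ s(2), of t] assms(2)[OF that] that by fastforce
    then show ?thesis by (intro exI[of _ "-1"]) simp
  next
    case False
    have "0 < g t" if "a < t" "t < b" for t
    proof -
      have "\<not> g t < 0" using False that by auto
      then show ?thesis using assms(2)[OF that] by linarith
    qed
    then show ?thesis by (intro exI[of _ 1]) simp
  qed
qed

text \<open>
  Since \<open>p t = A - B cos (2 t - d)\<close> satisfies \<open>p''' + 4 p' = 0\<close>, integration by parts gives
  \<open>(u''' + 4 u') p\<close> the periodic antiderivative \<open>H = u'' p - u' p' + (p'' + 4 p) u\<close>, in which
  \<open>p'' + 4 p\<close> is the constant \<open>4 A\<close>. A product that is positive off three points would make \<open>H\<close>
  strictly increasing over a whole period. Stating this through \<open>H\<close> makes orthogonality a matter
  of monotonicity, with no integrals.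
\<close>
lemma no_weight_with_sign:
  fixes u u1 u2 u3 :: "real \<Rightarrow> real"
  assumes u: "\<And>t. (u has_real_derivative u1 t) (at t)"
    and u1: "\<And>t. (u1 has_real_derivative u2 t) (at t)"
    and u2: "\<And>t. (u2 has_real_derivative u3 t) (at t)"
    and per: "\<And>t. u (t + pi) = u t"
    and xyz: "x < y" "y < z" "z < x + pi"
    and pos: "\<And>t. t \<in> {x<..<y} \<union> {y<..<z} \<union> {z<..<x + pi} \<Longrightarrow>
                0 < (u3 t + 4 * u1 t) * (A - B * cos (2 * t - d))"
  shows False
proof -
  define H where "H t = u2 t * (A - B * cos (2 * t - d)) - u1 t * (2 * B * sin (2 * t - d))
                        + 4 * A * u t" for t
  have H: "(H has_real_derivative (u3 t + 4 * u1 t) * (A - B * cos (2 * t - d))) (at t)" for t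
    unfolding H_def
    by (rule derivative_eq_intros u u1 u2 refl | simp)+ (simp add: algebra_simps)
  have inc: "H a < H b"
    if ab: "a < b"
      and p: "\<And>t. a < t \<Longrightarrow> t < b \<Longrightarrow> 0 < (u3 t + 4 * u1 t) * (A - B * cos (2 * t - d))" for a b
  proof (rule DERIV_pos_imp_increasing_open[OF ab])
    show "\<exists>D. (H has_real_derivative D) (at t) \<and> 0 < D" if "a < t" "t < b" for t
      using H p that by blast
    show "continuous_on {a..b} H"
      using H by (meson DERIV_isCont continuous_at_imp_continuous_on)
  qed
  have "H x < H y" "H y < H z" "H z < H (x + pi)"
    using xyz by (auto intro!: inc pos)
  moreover have "H (x + pi) = H x"
  proof -
    have per1: "u1 (t + pi) = u1 t" for t
      by (rule periodic_derivative[where f = u, OF u per])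
    moreover have "u2 (x + pi) = u2 x"
      by (rule periodic_derivative[where f = u1, OF u1 per1])
    moreover have "2 * (x + pi) - d = (2 * x - d) + 2 * pi"
      by simp
    ultimately show ?thesis
      unfolding H_def using per by (simp only: sin_periodic cos_periodic)
  qed
  ultimately show False by simp
qed

text \<open>
  Read cyclically, three signs are either all equal or exactly one of them differs from the other
  two. In the first case a constant weight will do. In the second, if \<open>a\<close> and \<open>b\<close> are the ends of
  the exceptional interval, then \<open>sin (t - a) * sin (t - b)\<close> has period \<open>pi\<close> and changes sign
  exactly at \<open>a\<close> and \<open>b\<close> modulo \<open>pi\<close>. The product formula shows that it has the form
  \<open>A - B * cos (2 * t - d)\<close>.
\<close>
lemma exists_weight_with_signs:
  fixes x y z e1 e2 e3 :: real
  assumes xyz: "x < y" "y < z" "z < x + pi"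
    and e: "e1 = 1 \<or> e1 = -1" "e2 = 1 \<or> e2 = -1" "e3 = 1 \<or> e3 = -1"
  obtains A B d where "\<And>t. x < t \<Longrightarrow> t < y \<Longrightarrow> 0 < e1 * (A - B * cos (2 * t - d))"
    and "\<And>t. y < t \<Longrightarrow> t < z \<Longrightarrow> 0 < e2 * (A - B * cos (2 * t - d))"
    and "\<And>t. z < t \<Longrightarrow> t < x + pi \<Longrightarrow> 0 < e3 * (A - B * cos (2 * t - d))"
proof -
  have prod: "c * cos (a - b) / 2 - c / 2 * cos (2 * t - (a + b)) = c * (sin (t - a) * sin (t - b))"
    for a b c t :: real
  proof -
    have "cos (a - b) = cos ((t - a) - (t - b))"
      by (metis cos_minus minus_diff_eq diff_diff_eq2 diff_add_cancel add.commute add_diff_cancel_left')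
    moreover have "2 * t - (a + b) = (t - a) + (t - b)" by simp
    ultimately show ?thesis
      by (simp only: sin_times_sin) (simp add: algebra_simps diff_divide_distrib)
  qed
  have pos: "sin (t - a) > 0" if "a < t" "t < a + pi" for a t
    using that by (intro sin_gt_zero) auto
  have neg: "sin (t - a) < 0" if "t < a" "a < t + pi" for a t
    using that sin_gt_zero[of "a - t"]
    by (metis add.commute diff_gt_0_iff_gt diff_less_eq minus_diff_eq neg_0_less_iff_less sin_minus)
  consider "e1 = e2" "e2 = e3" | "e2 = - e1" "e3 = e2" | "e3 = - e1" "e2 = e1" | "e2 = - e1" "e3 = e1"
    using e by fastforce
  then show thesis
  proof cases
    case 1
    show thesis by (rule that[of e1 0 0]) (use 1 e in auto)
  next
    case 2
    show thesis
      by (rule that[of "e2 * cos (x - y) / 2" "e2 / 2" "x + y"]; unfold prod)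
        (use 2 e xyz in \<open>auto simp: zero_less_mult_iff mult_less_0_iff pos neg\<close>)
  next
    case 3
    show thesis
      by (rule that[of "e3 * cos (x - z) / 2" "e3 / 2" "x + z"]; unfold prod)
        (use 3 e xyz in \<open>auto simp: zero_less_mult_iff mult_less_0_iff pos neg\<close>)
  next
    case 4
    show thesis
      by (rule that[of "e1 * cos (y - z) / 2" "e1 / 2" "y + z"]; unfold prod)
        (use 4 e xyz in \<open>auto simp: zero_less_mult_iff mult_less_0_iff pos neg\<close>)
  qed
qed

lemma zero_avoiding_three_points:
  fixes u u1 u2 u3 :: "real \<Rightarrow> real"
  assumes u: "\<And>t. (u has_real_derivative u1 t) (at t)"
    and u1: "\<And>t. (u1 has_real_derivative u2 t) (at t)"
    and u2: "\<And>t. (u2 has_real_derivative u3 t) (at t)"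
    and cont: "continuous_on UNIV u3"
    and per: "\<And>t. u (t + pi) = u t"
    and xyz: "x < y" "y < z" "z < x + pi"
  obtains t where "t \<in> {x<..<y} \<union> {y<..<z} \<union> {z<..<x + pi}" and "u3 t + 4 * u1 t = 0"
proof (rule ccontr)
  let ?g = "\<lambda>t. u3 t + 4 * u1 t"
  assume "\<not> thesis"
  with that have nz: "?g t \<noteq> 0" if "t \<in> {x<..<y} \<union> {y<..<z} \<union> {z<..<x + pi}" for t
    using that by blast
  have "continuous_on UNIV u1"
    using u1 by (meson DERIV_isCont continuous_at_imp_continuous_on)
  then have g: "continuous_on UNIV ?g"
    using cont by (intro continuous_intros)
  have nz1: "\<And>t. x < t \<Longrightarrow> t < y \<Longrightarrow> ?g t \<noteq> 0"
    and nz2: "\<And>t. y < t \<Longrightarrow> t < z \<Longrightarrow> ?g t \<noteq> 0"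
    and nz3: "\<And>t. z < t \<Longrightarrow> t < x + pi \<Longrightarrow> ?g t \<noteq> 0"
    using nz by simp_all
  obtain e1 where e1: "e1 = 1 \<or> e1 = -1" "\<And>t. x < t \<Longrightarrow> t < y \<Longrightarrow> 0 < e1 * ?g t"
    using continuous_nonzero_sign_const[OF g nz1] by blast
  obtain e2 where e2: "e2 = 1 \<or> e2 = -1" "\<And>t. y < t \<Longrightarrow> t < z \<Longrightarrow> 0 < e2 * ?g t"
    using continuous_nonzero_sign_const[OF g nz2] by blast
  obtain e3 where e3: "e3 = 1 \<or> e3 = -1" "\<And>t. z < t \<Longrightarrow> t < x + pi \<Longrightarrow> 0 < e3 * ?g t"
    using continuous_nonzero_sign_const[OF g nz3] by blast
  obtain A B d where w:
    "\<And>t. x < t \<Longrightarrow> t < y \<Longrightarrow> 0 < e1 * (A - B * cos (2 * t - d))"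
    "\<And>t. y < t \<Longrightarrow> t < z \<Longrightarrow> 0 < e2 * (A - B * cos (2 * t - d))"
    "\<And>t. z < t \<Longrightarrow> t < x + pi \<Longrightarrow> 0 < e3 * (A - B * cos (2 * t - d))"
    using exists_weight_with_signs[OF xyz e1(1) e2(1) e3(1)] by metis
  have mult: "0 < v * w" if "e = 1 \<or> e = -1" "0 < e * v" "0 < e * w" for e v w :: real
    using that by (auto simp: mult_neg_neg)
  show False
  proof (rule no_weight_with_sign[where u = u, OF u u1 u2 per xyz])
    fix t assume "t \<in> {x<..<y} \<union> {y<..<z} \<union> {z<..<x + pi}"
    then consider "x < t" "t < y" | "y < t" "t < z" | "z < t" "t < x + pi"
      by fastforce
    then show "0 < ?g t * (A - B * cos (2 * t - d))"
    proof cases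
      case 1
      show ?thesis by (rule mult[OF e1(1) e1(2)[OF 1] w(1)[OF 1]])
    next
      case 2
      show ?thesis by (rule mult[OF e2(1) e2(2)[OF 2] w(2)[OF 2]])
    next
      case 3
      show ?thesis by (rule mult[OF e3(1) e3(2)[OF 3] w(3)[OF 3]])
    qed
  qed
qed

text \<open>
  Fewer than four zeros can be enlarged to a set of exactly three points \<open>x < y < z\<close> of the
  half-open period that contains them all. The three points cut the shifted period from \<open>x\<close> to
  \<open>x + pi\<close> into open intervals, in one of which there is a further zero. Reduced modulo \<open>pi\<close>,
  it contradicts the choice of the points.
\<close>
lemma four_zeros_per_period:
  fixes u u1 u2 u3 :: "real \<Rightarrow> real"
  assumes u: "\<And>t. (u has_real_derivative u1 t) (at t)"
    and u1: "\<And>t. (u1 has_real_derivative u2 t) (at t)"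
    and u2: "\<And>t. (u2 has_real_derivative u3 t) (at t)"
    and cont: "continuous_on UNIV u3"
    and per: "\<And>t. u (t + pi) = u t"
  obtains W where "W \<subseteq> {0..<pi}" "finite W" "card W = 4" "\<And>w. w \<in> W \<Longrightarrow> u3 w + 4 * u1 w = 0"
proof -
  let ?Z = "{t \<in> {0..<pi}. u3 t + 4 * u1 t = 0}"
  have "infinite ?Z \<or> 4 \<le> card ?Z"
  proof (rule ccontr)
    assume "\<not> ?thesis"
    then have Z: "finite ?Z" "card ?Z \<le> 3" by auto
    \<comment> \<open>Pad the zeros with arbitrary points of the period, so that no separate treatment of two, one
      or no zeros is needed.\<close>
    have "infinite ({0..<pi} - ?Z)"
      using Z(1) infinite_Ico[of 0 pi] by (intro Diff_infinite_finite) auto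
    then obtain P where P: "P \<subseteq> {0..<pi} - ?Z" "finite P" "card P = 3 - card ?Z"
      using infinite_arbitrarily_large by blast
    define T where "T = ?Z \<union> P"
    have "card T = 3"
      unfolding T_def using P Z by (subst card_Un_disjoint) auto
    have T: "T \<subseteq> {0..<pi}" "?Z \<subseteq> T"
      using P unfolding T_def by auto
    define xs where "xs = sorted_list_of_set T"
    have "finite T" using P Z unfolding T_def by auto
    then have xs: "length xs = 3" "set xs = T" "sorted_wrt (<) xs"
      using \<open>card T = 3\<close> by (auto simp: xs_def)
    then obtain x y z where "xs = [x, y, z]"
      by (auto simp: length_Suc_conv eval_nat_numeral)
    with xs have xyz: "x < y" "y < z" "T = {x, y, z}" by auto
    then have "z < x + pi" using T by auto
    then obtain t where t: "t \<in> {x<..<y} \<union> {y<..<z} \<union> {z<..<x + pi}" "u3 t + 4 * u1 t = 0"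
      using zero_avoiding_three_points[where u = u, OF u u1 u2 cont per xyz(1,2)] by blast
    have per1: "u1 (t + pi) = u1 t" for t by (rule periodic_derivative[where f = u, OF u per])
    have per2: "u2 (t + pi) = u2 t" for t by (rule periodic_derivative[where f = u1, OF u1 per1])
    have per3: "u3 (t + pi) = u3 t" for t by (rule periodic_derivative[where f = u2, OF u2 per2])
    have bounds: "0 \<le> x" "z < pi" and "x < t" "t < x + pi"
      using T(1) t(1) xyz by auto
    show False
    proof (cases "t < pi")
      case True
      then have "t \<in> ?Z" using bounds \<open>x < t\<close> t(2) by simp
      then have "t \<in> {x, y, z}" using T(2) xyz(3) by blast
      then show False using t(1) xyz(1,2) by auto
    next
      case False
      \<comment> \<open>The zero lies at or beyond \<open>pi\<close>; shifted back it falls to the left of \<open>x\<close>.\<close>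
      have "u3 (t - pi) + 4 * u1 (t - pi) = 0"
        using t(2) per1[of "t - pi"] per3[of "t - pi"] by simp
      then have "t - pi \<in> ?Z"
        using False bounds \<open>t < x + pi\<close> xyz(1,2) by simp
      then have "t - pi \<in> {x, y, z}" using T(2) xyz(3) by blast
      then show False using \<open>t < x + pi\<close> xyz(1,2) by auto
    qed
  qed
  then obtain W where "W \<subseteq> ?Z" "card W = 4" "finite W"
    by (metis (no_types, lifting) infinite_arbitrarily_large obtain_subset_with_card_n)
  then show thesis by (intro that[of W]) auto
qed

section \<open>Support function and curvature in the Gauss parametrization\<close>

lemma inj_on_circle_point: "inj_on circle_point {0..<2 * pi}"
proof (rule inj_onI)
  fix a b assume ab: "a \<in> {0..<2 * pi}" "b \<in> {0..<2 * pi}" "circle_point a = circle_point b"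
  have "cos a = circle_point a $ 1" "sin a = circle_point a $ 2" for a
    by (simp_all add: circle_point_def)
  then have "sin a = sin b \<and> cos a = cos b"
    by (simp add: ab(3))
  then obtain n :: int where n: "a = b + 2 * pi * n"
    unfolding sin_cos_eq_iff by blast
  have "2 * pi * real_of_int n < 2 * pi * 1" "2 * pi * (-1) < 2 * pi * real_of_int n"
    using n ab by (simp_all only: atLeastLessThan_iff) linarith+
  then have "real_of_int n < 1" "- 1 < real_of_int n"
    by (metis mult_less_cancel_left_pos mult_pos_pos pi_gt_zero zero_less_numeral)+
  then have "n = 0" by linarith
  with n show "a = b" by simp
qed

lemma smooth_has_vector_derivative:
  assumes "smooth f"
  shows "((vderiv ^^ n) f has_vector_derivative (vderiv ^^ Suc n) f t) (at t)"
  using assms unfolding smooth_def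
  by (simp add: vderiv_def[of _ t] vector_derivative_works[symmetric])

lemma has_real_derivative_vec_nth:
  fixes f :: "real \<Rightarrow> real^2"
  assumes "(f has_vector_derivative f') (at t)"
  shows "((\<lambda>t. f t $ i) has_real_derivative f' $ i) (at t)"
  using bounded_linear.has_vector_derivative[OF bounded_linear_vec_nth assms]
  by (simp add: has_real_derivative_iff_has_vector_derivative)

lemma inner_circle_point: "v \<bullet> circle_point t = v $ 1 * cos t + v $ 2 * sin t"
  by (simp add: circle_point_def inner_vec_def UNIV_2)

lemma circle_point_add_pi: "circle_point (t + pi) = - circle_point t"
  by (simp add: circle_point_def vec_eq_iff forall_2)

text \<open>
  By the outer normal condition \<open>support_function \<gamma> t\<close> is the maximum of \<open>q \<bullet> circle_point t\<close> over
  the points \<open>q\<close> of the curve. This maximum does not change when both \<open>q\<close> and the normal are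
  negated. Origin symmetry speaks only of the set of curve points, which is all that the maximum
  depends on.
\<close>
lemma support_function_periodic:
  assumes "origin_symmetric \<gamma>" and "gauss_parametrization \<gamma>"
  shows "support_function \<gamma> (t + pi) = support_function \<gamma> t"
proof -
  have le: "q \<bullet> circle_point t \<le> support_function \<gamma> t" if "q \<in> curve_points \<gamma>" for q t
    using assms(2) that
    by (auto simp: gauss_parametrization_def outer_unit_normal_def support_function_def
        inner_diff_left)
  have mem: "angular \<gamma> t \<in> curve_points \<gamma>" for t
  proof -
    have "norm (circle_point t) = 1"
      using assms(2) by (simp add: gauss_parametrization_def outer_unit_normal_def)
    then show ?thesis by (simp add: angular_def curve_points_def)
  qed
  have neg: "- angular \<gamma> t \<in> curve_points \<gamma>" for t
    using mem[of t] assms(1) unfolding origin_symmetric_def by blast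
  show ?thesis
    using le[OF neg[of t], of "t + pi"] le[OF neg[of "t + pi"], of t]
    by (simp add: circle_point_add_pi support_function_def)
qed

text \<open>
  Let \<open>n = circle_point t\<close> and let \<open>T = n'\<close> be the unit tangent. The curve velocity is orthogonal to
  \<open>n\<close>, so it is \<open>\<rho> T\<close> for a scalar \<open>\<rho>\<close>, and \<open>s = \<gamma> \<bullet> n\<close> has the derivatives \<open>s' = \<gamma> \<bullet> T\<close>
  and \<open>s'' = \<rho> - s\<close>. The absolute value in the formula for the curvature stands because the sign
  of \<open>\<rho>\<close> is left open: both signs lead to the same critical points.
\<close>
lemma support_function_derivatives:
  assumes smooth: "smooth (angular \<gamma>)" and gauss: "gauss_parametrization \<gamma>"
  obtains s' \<rho> \<rho>' where
    "\<And>t. (support_function \<gamma> has_real_derivative s' t) (at t)"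
    "\<And>t. (s' has_real_derivative \<rho> t - support_function \<gamma> t) (at t)"
    "\<And>t. (\<rho> has_real_derivative \<rho>' t) (at t)"
    "continuous_on UNIV \<rho>'"
    "\<And>t. curvature \<gamma> t = 1 / \<bar>\<rho> t\<bar>"
proof -
  define c where "c i t = angular \<gamma> t $ i" for i t
  define v where "v i t = vderiv (angular \<gamma>) t $ i" for i t
  define a where "a i t = vderiv (vderiv (angular \<gamma>)) t $ i" for i t
  define s' where "s' t = c 2 t * cos t - c 1 t * sin t" for t
  define \<rho> where "\<rho> t = v 2 t * cos t - v 1 t * sin t" for t
  define \<rho>' where "\<rho>' t = a 2 t * cos t - a 1 t * sin t" for t
  have c: "(c i has_real_derivative v i t) (at t)" for i t
    using has_real_derivative_vec_nth[OF smooth_has_vector_derivative[OF smooth, of 0]]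
    by (simp add: c_def[abs_def] v_def[abs_def])
  have v: "(v i has_real_derivative a i t) (at t)" for i t
    using has_real_derivative_vec_nth[OF smooth_has_vector_derivative[OF smooth, of 1]]
    by (simp add: a_def[abs_def] v_def[abs_def])
  have "\<exists>D. (a i has_real_derivative D) (at t)" for i t
    using has_real_derivative_vec_nth[OF smooth_has_vector_derivative[OF smooth, of 2]]
    by (auto simp: a_def[abs_def] numeral_2_eq_2)
  then have a: "continuous_on UNIV (a i)" for i
    by (meson DERIV_isCont continuous_at_imp_continuous_on)
  have tan: "v 1 t * cos t + v 2 t * sin t = 0" for t
  proof -
    have "vderiv (angular \<gamma>) t \<bullet> circle_point t = 0"
      using gauss by (simp add: gauss_parametrization_def outer_unit_normal_def inner_commute)
    then show ?thesis by (simp add: inner_circle_point v_def)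
  qed
  \<comment> \<open>Differentiating the orthogonality of velocity and normal yields the normal acceleration.\<close>
  have an: "a 1 t * cos t + a 2 t * sin t = - \<rho> t" for t
  proof -
    have "((\<lambda>t. v 1 t * cos t + v 2 t * sin t) has_real_derivative
            a 1 t * cos t + a 2 t * sin t + \<rho> t) (at t)"
      unfolding \<rho>_def by (rule derivative_eq_intros v refl)+ simp
    moreover have "((\<lambda>t. v 1 t * cos t + v 2 t * sin t) has_real_derivative 0) (at t)"
      by (simp add: tan)
    ultimately show ?thesis using DERIV_unique by fastforce
  qed
  have s: "support_function \<gamma> = (\<lambda>t. c 1 t * cos t + c 2 t * sin t)"
    by (simp add: fun_eq_iff support_function_def inner_circle_point c_def)
  have v1: "v 1 t = - \<rho> t * sin t" for t
  proof -
    have "v 1 t = v 1 t * ((sin t)\<^sup>2 + (cos t)\<^sup>2) - (v 1 t * cos t + v 2 t * sin t) * cos t"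
      by (simp add: tan)
    also have "\<dots> = - \<rho> t * sin t" unfolding \<rho>_def by algebra
    finally show ?thesis .
  qed
  have v2: "v 2 t = \<rho> t * cos t" for t
  proof -
    have "v 2 t = v 2 t * ((sin t)\<^sup>2 + (cos t)\<^sup>2) - (v 1 t * cos t + v 2 t * sin t) * sin t"
      by (simp add: tan)
    also have "\<dots> = \<rho> t * cos t" unfolding \<rho>_def by algebra
    finally show ?thesis .
  qed
  show thesis
  proof
    show "(support_function \<gamma> has_real_derivative s' t) (at t)" for t
      unfolding s
      by (rule derivative_eq_intros c refl)+ (use tan[of t] in \<open>simp add: s'_def algebra_simps\<close>)
    show "(s' has_real_derivative \<rho> t - support_function \<gamma> t) (at t)" for t
      unfolding s'_def[abs_def] s
      by (rule derivative_eq_intros c refl)+ (simp add: \<rho>_def algebra_simps)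
    show "(\<rho> has_real_derivative \<rho>' t) (at t)" for t
      unfolding \<rho>_def[abs_def]
      by (rule derivative_eq_intros v refl)+ (use tan[of t] in \<open>simp add: \<rho>'_def algebra_simps\<close>)
    show "continuous_on UNIV \<rho>'"
      unfolding \<rho>'_def[abs_def] by (intro continuous_intros a)
    show "curvature \<gamma> t = 1 / \<bar>\<rho> t\<bar>" for t
    proof -
      have "norm (vderiv (angular \<gamma>) t) = sqrt ((v 1 t)\<^sup>2 + (v 2 t)\<^sup>2)"
        by (simp add: norm_vec_def L2_set_def UNIV_2 v_def)
      also have "(v 1 t)\<^sup>2 + (v 2 t)\<^sup>2 = (\<rho> t)\<^sup>2 * ((sin t)\<^sup>2 + (cos t)\<^sup>2)"
        unfolding v1 v2 by algebra
      finally have n: "norm (vderiv (angular \<gamma>) t) = \<bar>\<rho> t\<bar>" by simp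
      have "v 1 t * a 2 t - v 2 t * a 1 t = - \<rho> t * (a 1 t * cos t + a 2 t * sin t)"
        unfolding v1 v2 by (simp add: algebra_simps)
      also have "\<dots> = \<bar>\<rho> t\<bar>\<^sup>2" by (simp add: an power2_eq_square)
      finally have "curvature \<gamma> t = \<bar>\<rho> t\<bar>\<^sup>2 / \<bar>\<rho> t\<bar> ^ 3"
        by (simp add: curvature_def n v_def a_def Let_def)
      then show ?thesis by (simp add: power3_eq_cube power2_eq_square)
    qed
  qed
qed

section \<open>Critical points of the affine support function\<close>

text \<open>
  As \<open>\<sigma> = s * root 3 \<bar>\<rho>\<bar>\<close>, the derivative of \<open>\<sigma>\<close> is
  \<open>(3 s' \<rho> + s \<rho>') * sgn \<rho> / (3 \<bar>\<rho>\<bar> powr (2/3))\<close>.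
\<close>
lemma affine_support_function_critical:
  assumes s: "(support_function \<gamma> has_real_derivative s') (at t)"
    and \<rho>: "(\<rho> has_real_derivative \<rho>') (at t)"
    and curv: "\<And>t. curvature \<gamma> t = 1 / \<bar>\<rho> t\<bar>" and "\<rho> t \<noteq> 0"
    and crit: "3 * s' * \<rho> t + support_function \<gamma> t * \<rho>' = 0"
  shows "(affine_support_function \<gamma> has_real_derivative 0) (at t)"
proof -
  let ?m = "root 3 \<bar>\<rho> t\<bar>"
  have "affine_support_function \<gamma> = (\<lambda>t. support_function \<gamma> t * root 3 \<bar>\<rho> t\<bar>)"
    by (simp add: fun_eq_iff affine_support_function_def curv real_root_divide)
  moreover have "((\<lambda>t. root 3 \<bar>\<rho> t\<bar>) has_real_derivative
      inverse (3 * ?m ^ 2) * (\<rho>' * sgn (\<rho> t))) (at t)"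
  proof -
    have "(abs has_real_derivative sgn (\<rho> t)) (at (\<rho> t))"
      using has_derivative_norm[of "\<rho> t"] \<open>\<rho> t \<noteq> 0\<close>
      by (simp add: has_field_derivative_def real_norm_def[abs_def] mult_commute_abs)
    from DERIV_chain2[OF this \<rho>]
    have abs: "((\<lambda>t. \<bar>\<rho> t\<bar>) has_real_derivative \<rho>' * sgn (\<rho> t)) (at t)"
      by (simp only: mult.commute)
    have "(root 3 has_real_derivative inverse (3 * ?m ^ 2)) (at \<bar>\<rho> t\<bar>)"
      using DERIV_real_root[of 3 "\<bar>\<rho> t\<bar>"] \<open>\<rho> t \<noteq> 0\<close> by simp
    from DERIV_chain2[OF this abs] show ?thesis .
  qed
  ultimately have "(affine_support_function \<gamma> has_real_derivative
      s' * ?m + inverse (3 * ?m ^ 2) * (\<rho>' * sgn (\<rho> t)) * support_function \<gamma> t) (at t)"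
    by (simp only: DERIV_mult[OF s, where g = "\<lambda>t. root 3 \<bar>\<rho> t\<bar>"])
  moreover have "s' * ?m + inverse (3 * ?m ^ 2) * (\<rho>' * sgn (\<rho> t)) * support_function \<gamma> t = 0"
  proof -
    have "?m \<noteq> 0" using \<open>\<rho> t \<noteq> 0\<close> by simp
    then have "s' * ?m = s' * ?m ^ 3 * inverse (?m ^ 2)"
      by (simp add: field_simps power3_eq_cube power2_eq_square)
    moreover have "?m ^ 3 = sgn (\<rho> t) * \<rho> t"
    proof -
      have "?m ^ 3 = \<bar>\<rho> t\<bar>" by (simp add: real_root_pow_pos2)
      then show ?thesis by (simp only: abs_sgn mult.commute)
    qed
    ultimately have m: "s' * ?m = s' * (sgn (\<rho> t) * \<rho> t) * inverse (?m ^ 2)"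
      by (simp only:)
    have "s' * ?m + inverse (3 * ?m ^ 2) * (\<rho>' * sgn (\<rho> t)) * support_function \<gamma> t
        = inverse (3 * ?m ^ 2) * sgn (\<rho> t) * (3 * s' * \<rho> t + support_function \<gamma> t * \<rho>')"
      by (subst m) (simp add: algebra_simps)
    then show ?thesis by (simp add: crit)
  qed
  ultimately show ?thesis by simp
qed

theorem theorem6p1:
  fixes \<gamma> :: "real^2 \<Rightarrow> real^2"
  assumes "smooth_simple_closed_curve \<gamma>"
    and "origin_symmetric \<gamma>"
    and "strictly_convex_curve \<gamma>"
    and "gauss_parametrization \<gamma>"
    and "\<And>\<theta>. curvature \<gamma> \<theta> > 0"
  shows "\<exists>Z. Z \<subseteq> critical_points (affine_support_function \<gamma>) \<and> finite Z \<and> card Z = 8"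
proof -
  let ?s = "support_function \<gamma>"
  have "smooth (angular \<gamma>)"
    using assms(1) by (simp add: smooth_simple_closed_curve_def)
  from support_function_derivatives[OF this assms(4)]
  obtain s' \<rho> \<rho>' where s: "\<And>t. (?s has_real_derivative s' t) (at t)"
    and s': "\<And>t. (s' has_real_derivative \<rho> t - ?s t) (at t)"
    and \<rho>: "\<And>t. (\<rho> has_real_derivative \<rho>' t) (at t)"
    and cont: "continuous_on UNIV \<rho>'"
    and curv: "\<And>t. curvature \<gamma> t = 1 / \<bar>\<rho> t\<bar>"
    by blast
  have nonzero: "\<rho> t \<noteq> 0" for t
    using assms(5)[of t] unfolding curv by force
  have per: "?s (t + pi) = ?s t" for t
    by (rule support_function_periodic[OF assms(2,4)])
  \<comment> \<open>The derivatives of \<open>s\<^sup>2\<close>, with \<open>\<rho> - s\<close> written for \<open>s''\<close>.\<close>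
  let ?u = "\<lambda>t. (?s t)\<^sup>2" and ?u1 = "\<lambda>t. 2 * ?s t * s' t"
    and ?u2 = "\<lambda>t. 2 * (s' t)\<^sup>2 + 2 * ?s t * (\<rho> t - ?s t)"
    and ?u3 = "\<lambda>t. 6 * s' t * (\<rho> t - ?s t) + 2 * ?s t * (\<rho>' t - s' t)"
  have u: "(?u has_real_derivative ?u1 t) (at t)" for t
    by (rule derivative_eq_intros s refl)+ simp
  have u1: "(?u1 has_real_derivative ?u2 t) (at t)" for t
    by (rule derivative_eq_intros s s' refl)+ (simp add: algebra_simps power2_eq_square)
  have u2: "(?u2 has_real_derivative ?u3 t) (at t)" for t
    by (rule derivative_eq_intros s s' \<rho> refl)+ (simp add: algebra_simps power2_eq_square)
  have c3: "continuous_on UNIV ?u3"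
    using s s' \<rho> cont
    by (intro continuous_intros) (meson DERIV_isCont continuous_at_imp_continuous_on)+
  obtain W where W: "W \<subseteq> {0..<pi}" "finite W" "card W = 4"
    and zero: "\<And>w. w \<in> W \<Longrightarrow> ?u3 w + 4 * ?u1 w = 0"
    using four_zeros_per_period[where u = ?u, OF u u1 u2 c3] by (simp only: per) blast
  have per': "s' (t + pi) = s' t" for t
    by (rule periodic_derivative[where f = ?s, OF s per])
  have per\<rho>: "\<rho> (t + pi) = \<rho> t" for t
    using periodic_derivative[where f = s', OF s' per', of t] per[of t] by simp
  have per\<rho>': "\<rho>' (t + pi) = \<rho>' t" for t
    by (rule periodic_derivative[where f = \<rho>, OF \<rho> per\<rho>])
  \<comment> \<open>The terms without \<open>\<rho>\<close> or its derivative cancel: this is where the coefficient 4 comes from.\<close>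
  have zero': "3 * s' w * \<rho> w + ?s w * \<rho>' w = 0" if "w \<in> W" for w
    using zero[OF that] by (simp add: algebra_simps)
  \<comment> \<open>The circle has length \<open>2 * pi\<close>: each zero in a period gives two antipodal critical points.\<close>
  define V where "V = W \<union> (\<lambda>w. w + pi) ` W"
  have "W \<inter> (\<lambda>w. w + pi) ` W = {}"
  proof -
    have "w' + pi \<notin> W" if "w' \<in> W" for w'
    proof -
      have "0 \<le> w'" using W(1) that by auto
      then have "w' + pi \<notin> {0..<pi}" by simp
      then show ?thesis using W(1) by blast
    qed
    then show ?thesis by blast
  qed
  then have V: "finite V" "card V = 8"
    unfolding V_def using W by (auto simp: card_Un_disjoint card_image)
  have "V \<subseteq> {0..<2 * pi}"
    unfolding V_def using W(1) by force
  then have "card (circle_point ` V) = 8"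
    using V by (metis card_image inj_on_circle_point inj_on_subset)
  moreover have "(affine_support_function \<gamma> has_real_derivative 0) (at t)" if "t \<in> V" for t
    using that zero' unfolding V_def
    by (intro affine_support_function_critical[where \<rho> = \<rho>, OF s \<rho> curv nonzero])
      (auto simp: per per' per\<rho> per\<rho>')
  then have "circle_point ` V \<subseteq> critical_points (affine_support_function \<gamma>)"
    unfolding critical_points_def by blast
  ultimately show ?thesis using V(1) by blast
qed

end
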